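(* Let $\alpha_0\in\mathbb{R}$ and let $\mathcal{F}$ be the set of all continuously differentiable functions $f:[0,1]\to\mathbb{R}$ with $\int_0^1 f(x)\,dx=\alpha_0$. Then there are no real numbers $A\le B$ such that $[A,B]$ is the optimal range interval of $\mathcal{F}$. The optimal length of $\mathcal{F}$ is $L=0$.
   Context: For a set $\mathcal{F}$ of continuously differentiable functions on $[0,1]$: (1) The optimal range interval of $\mathcal{F}$ is the largest interval $[A,B]$ (with $A\le B$ real, $A=B$ allowed) such that $[A,B]\subseteq \mathrm{Range}(f')$ for every $f\in\mathcal{F}$; that is, $[A,B]$ has this property and contains every other such interval with this property. (2) The optimal length of $\mathcal{F}$ is the largest number $L\ge 0$ such that for every $f\in\mathcal{F}$ there is an interval $[a,b]$ (possibly depending on $f$) with $b-a=L$ and $[a,b]\subseteq \mathrm{Range}(f')$. Here $\mathrm{Range}(f')=f'([0,1])$. *)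

theory Defs
  imports "HOL-Analysis.Analysis"
begin

(* A function on [0,1] is represented by a total function real => real; every notion below
   depends only on its restriction to [0,1].  In particular the derivative at the endpoints
   is one-sided, which is why deriv and C1_differentiable_on (two-sided) are not used. *)

definition deriv01 :: "(real \<Rightarrow> real) \<Rightarrow> real \<Rightarrow> real" where
  "deriv01 f x = vector_derivative f (at x within {0..1})"

definition C1_on01 :: "(real \<Rightarrow> real) \<Rightarrow> bool" where
  "C1_on01 f \<longleftrightarrow> f differentiable_on {0..1} \<and> continuous_on {0..1} (deriv01 f)"

definition deriv_range :: "(real \<Rightarrow> real) \<Rightarrow> real set" where
  "deriv_range f = deriv01 f ` {0..1}"

definition common_range_interval :: "(real \<Rightarrow> real) set \<Rightarrow> real \<Rightarrow> real \<Rightarrow> bool" where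
  "common_range_interval F A B \<longleftrightarrow> A \<le> B \<and> (\<forall>f\<in>F. {A..B} \<subseteq> deriv_range f)"

definition is_optimal_range_interval :: "(real \<Rightarrow> real) set \<Rightarrow> real \<Rightarrow> real \<Rightarrow> bool" where
  "is_optimal_range_interval F A B \<longleftrightarrow>
     common_range_interval F A B \<and>
     (\<forall>A' B'. common_range_interval F A' B' \<longrightarrow> {A'..B'} \<subseteq> {A..B})"

definition admissible_length :: "(real \<Rightarrow> real) set \<Rightarrow> real \<Rightarrow> bool" where
  "admissible_length F L \<longleftrightarrow>
     0 \<le> L \<and> (\<forall>f\<in>F. \<exists>a b. b - a = L \<and> {a..b} \<subseteq> deriv_range f)"

definition is_optimal_length :: "(real \<Rightarrow> real) set \<Rightarrow> real \<Rightarrow> bool" where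
  "is_optimal_length F L \<longleftrightarrow>
     admissible_length F L \<and> (\<forall>L'. admissible_length F L' \<longrightarrow> L' \<le> L)"

end

theory Submission
  imports Defs
begin

text \<open>Prescribing the integral fixes only the additive constant, never the slope: for every
  real s some affine function of slope s lies in \<open>F\<close> (\<open>integral_affine\<close>),
  and its derivative range is the single point s (\<open>deriv_range_affine\<close>). Two distinct
  slopes leave no common value, and one such function already forces every admissible length to be
  0. Length 0 is attained by degenerate intervals.\<close>

lemma deriv01_affine:
  assumes "x \<in> {0..1}"
  shows "deriv01 (\<lambda>x. s * x + c) x = s"
  unfolding deriv01_def
\<comment> \<open>Derivatives within a nondegenerate closed interval are unique, also at the
  endpoints, where they are one-sided.\<close>
proof (rule vector_derivative_within_closed_interval)
  show "((\<lambda>x. s * x + c) has_vector_derivative s) (at x within {0..1})"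
    by (auto intro!: derivative_eq_intros)
qed (use assms in auto)

lemma C1_on01_affine: "C1_on01 (\<lambda>x. s * x + c)"
proof -
  have "continuous_on {0..1} (deriv01 (\<lambda>x. s * x + c)) \<longleftrightarrow> continuous_on {0..1} (\<lambda>x::real. s)"
    by (intro continuous_on_cong refl deriv01_affine)
  moreover have "(\<lambda>x. s * x + c) differentiable_on {0..1}"
    by (intro derivative_intros)
  ultimately show ?thesis
    by (simp add: C1_on01_def)
qed

lemma deriv_range_affine: "deriv_range (\<lambda>x. s * x + c) = {s}"
proof -
  have "deriv_range (\<lambda>x. s * x + c) = (\<lambda>_. s) ` {0..1::real}"
    unfolding deriv_range_def by (intro image_cong refl deriv01_affine)
  then show ?thesis by (simp add: image_constant_conv)
qed

lemma integral_affine: "integral {0..1} (\<lambda>x::real. s * x + c) = s / 2 + c"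
proof -
  have "((\<lambda>x. s * x + c) has_integral (s * 1\<^sup>2 / 2 + c * 1) - (s * 0\<^sup>2 / 2 + c * 0)) {0..1}"
    by (rule fundamental_theorem_of_calculus) (auto intro!: derivative_eq_intros
        simp flip: has_real_derivative_iff_has_vector_derivative)
  then show ?thesis by (simp add: integral_unique)
qed

theorem proposition1:
  fixes \<alpha>0 :: real and F :: "(real \<Rightarrow> real) set"
  assumes "F = {f. C1_on01 f \<and> integral {0..1} f = \<alpha>0}"
  shows "\<not> (\<exists>A B. A \<le> B \<and> is_optimal_range_interval F A B) \<and> is_optimal_length F 0"
proof -
  have ex: "\<exists>f\<in>F. deriv_range f = {s}" for s
  proof
    \<comment> \<open>The constant compensates for the s / 2 that the linear term adds to the
      integral.\<close>
    show "(\<lambda>x. s * x + (\<alpha>0 - s / 2)) \<in> F"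
      using assms by (simp add: C1_on01_affine integral_affine)
  qed (rule deriv_range_affine)
  have no_common: "\<not> common_range_interval F A B" for A B
  proof
    assume "common_range_interval F A B"
    \<comment> \<open>As A \<le> B, the point A lies in the interval, hence in every derivative
      range; any s other than A is then absurd.\<close>
    then have "A \<in> {s}" for s
      using ex[of s] unfolding common_range_interval_def by fastforce
    from this[of "A + 1"] show False by simp
  qed
  have "admissible_length F 0"
    unfolding admissible_length_def
  proof (intro conjI ballI)
    fix f
    have "{deriv01 f 0..deriv01 f 0} \<subseteq> deriv_range f"
      by (auto simp: deriv_range_def)
    then show "\<exists>a b. b - a = 0 \<and> {a..b} \<subseteq> deriv_range f"
      using diff_self by blast
  qed simp
  moreover have "L \<le> 0" if L: "admissible_length F L" for L
  proof -
    \<comment> \<open>The bound 0 \<le> L makes \<open>{a..b}\<close> nonempty, so both endpoints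
      lie in the singleton.\<close>
    obtain a b where "0 \<le> L" "b - a = L" "{a..b} \<subseteq> {0}"
      using L ex[of 0] unfolding admissible_length_def by metis
    moreover from this have "a \<in> {0}" "b \<in> {0}" by auto
    ultimately show ?thesis by simp
  qed
  ultimately show ?thesis
    using no_common by (simp add: is_optimal_range_interval_def is_optimal_length_def)
qed

end
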